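(* Let $n\ge 1$, let $\xi\subset\mathbb{C}^2$ be a length $n$ closed subscheme supported at the origin whose ideal $I_\xi\subset\mathbb{C}[x,y]$ is generated by monomials, and let $\mu_\xi$ be the corresponding Young diagram. Then $$\operatorname{rank}(\alpha_n|_{[\xi]})=\max(\Delta h)+\max(\Delta v),$$ i.e. the rank of $\alpha_n|_{[\xi]}$ is the maximum of the horizontal steps of $\mu_\xi$ plus the maximum of the vertical steps of $\mu_\xi$.
   Context: Young diagram and steps: for a monomial ideal $I_\xi$ of finite colength, $\mu_\xi:=\{(i,j)\in\mathbb{N}^2 \mid x^iy^j\notin I_\xi\}$ (with $0\in\mathbb{N}$), regarded as a union of unit boxes. Trace the top perimeter of the diagram from the top left to the bottom right; $\Delta h$ is the sequence of lengths of the successive horizontal steps and $\Delta v$ the sequence of lengths of the successive vertical steps. Equivalently, if $x^{a_0}y^{b_0},\dots,x^{a_m}y^{b_m}$ are the minimal monomial generators of $I_\xi$ with $0=a_0<a_1<\dots<a_m$ and $b_0>b_1>\dots>b_m=0$, then $\Delta h=(a_1-a_0,\dots,a_m-a_{m-1})$ and $\Delta v=(b_0-b_1,\dots,b_{m-1}-b_m)$. For example, $I_\xi=(y^4,x^2y^2,x^3y,x^7)$ has $\Delta h=(2,1,4)$ and $\Delta v=(2,1,1)$. The map $\alpha_n$: $(\mathbb{C}^2)^{[n]}$ is the Hilbert scheme of length $n$ closed subschemes of $\mathbb{C}^2=\operatorname{Spec}\mathbb{C}[x,y]$. There is a map of vector bundles $\alpha_n:(T_{\mathbb{C}^2})^{[n]}\to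 T_{(\mathbb{C}^2)^{[n]}}$, where $(T_{\mathbb{C}^2})^{[n]}=p_{2*}p_1^*T_{\mathbb{C}^2}$ ($p_1,p_2$ the projections of the universal family $\mathcal{Z}_n\subset\mathbb{C}^2\times(\mathbb{C}^2)^{[n]}$), obtained by applying $p_{2*}$ to the restriction to $p_1^*T_{\mathbb{C}^2}$ of the normal map $T_{\mathbb{C}^2\times(\mathbb{C}^2)^{[n]}}|_{\mathcal{Z}_n}\to\mathcal{H}om(I_{\mathcal{Z}_n}/I_{\mathcal{Z}_n}^2,\mathcal{O}_{\mathcal{Z}_n})$. On fibers at $[\xi]$, writing $\mathbb{C}[\xi]=\mathbb{C}[x,y]/I_\xi$, it is the $\mathbb{C}$-linear map $$\alpha_n|_{[\xi]}:\ \mathbb{C}[\xi]\,\tfrac{\partial}{\partial x}\oplus\mathbb{C}[\xi]\,\tfrac{\partial}{\partial y}\to\operatorname{Hom}_{\mathbb{C}[x,y]}(I_\xi,\mathbb{C}[\xi]),\qquad \delta\mapsto\big(f\mapsto\delta(f)|_\xi\big),$$ and $\operatorname{rank}(\alpha_n|_{[\xi]})$ is its rank as a linear map. *)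

theory Defs
  imports "Jordan_Normal_Form.VS_Connect" "HOL-Algebra.QuotRing"
begin

text \<open>
  \<open>\<complex>[x,y]\<close> is the type \<^typ>\<open>complex poly poly\<close>: the outer indeterminate is \<open>y\<close>, the coefficients
  are polynomials in \<open>x\<close>.
\<close>

abbreviation CC :: "complex ring" where
  "CC \<equiv> class_ring"

abbreviation CXY :: "complex poly poly ring" where
  "CXY \<equiv> class_ring"

abbreviation const_xy :: "complex \<Rightarrow> complex poly poly" where
  "const_xy c \<equiv> [:[:c:]:]"

definition monomial_xy :: "nat \<Rightarrow> nat \<Rightarrow> complex poly poly" where
  "monomial_xy i j = monom (monom 1 i) j"

definition eval_xy :: "complex poly poly \<Rightarrow> complex \<Rightarrow> complex \<Rightarrow> complex" where
  "eval_xy f a b = poly (poly f [:b:]) a"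

definition dx :: "complex poly poly \<Rightarrow> complex poly poly" where
  "dx f = map_poly pderiv f"

definition dy :: "complex poly poly \<Rightarrow> complex poly poly" where
  "dy f = pderiv f"

abbreviation residue_class :: "complex poly poly set \<Rightarrow> complex poly poly \<Rightarrow> complex poly poly set" where
  "residue_class I f \<equiv> I +>\<^bsub>CXY\<^esub> f"

text \<open>
  Modules over \<open>\<complex>[x,y]\<close> as records; the fields \<open>mult\<close> and \<open>one\<close> are part of the record type but
  play no role in a module.
\<close>

definition quot_module ::
    "complex poly poly set \<Rightarrow> (complex poly poly, complex poly poly set) module" where
  "quot_module I =
     \<lparr>carrier = carrier (CXY Quot I), mult = mult (CXY Quot I), one = one (CXY Quot I),
      zero = zero (CXY Quot I), add = add (CXY Quot I),
      smult = (\<lambda>r X. residue_class I r \<otimes>\<^bsub>CXY Quot I\<^esub> X)\<rparr>"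

definition ideal_module ::
    "complex poly poly set \<Rightarrow> (complex poly poly, complex poly poly) module" where
  "ideal_module I = \<lparr>carrier = I, mult = (*), one = 1, zero = 0, add = (+), smult = (*)\<rparr>"

text \<open>
  \<open>Hom\<^bsub>\<complex>[x,y]\<^esub>(M, N)\<close>; homomorphisms are taken extensional on the carrier of \<open>M\<close>, so that equality
  of functions is equality of homomorphisms.
\<close>

definition hom_module ::
    "(complex poly poly, 'm) module \<Rightarrow> (complex poly poly, 'n) module
      \<Rightarrow> (complex poly poly, 'm \<Rightarrow> 'n) module" where
  "hom_module M N =
     \<lparr>carrier = LinearCombinations.module_hom CXY M N \<inter> extensional (carrier M),
      mult = undefined, one = undefined,
      zero = (\<lambda>m\<in>carrier M. \<zero>\<^bsub>N\<^esub>),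
      add = (\<lambda>\<phi> \<psi>. \<lambda>m\<in>carrier M. \<phi> m \<oplus>\<^bsub>N\<^esub> \<psi> m),
      smult = (\<lambda>r \<phi>. \<lambda>m\<in>carrier M. r \<odot>\<^bsub>N\<^esub> \<phi> m)\<rparr>"

text \<open>Restriction of scalars along \<open>\<complex> \<rightarrow> \<complex>[x,y]\<close>.\<close>

definition over_C :: "(complex poly poly, 'm) module \<Rightarrow> (complex, 'm) module" where
  "over_C M =
     \<lparr>carrier = carrier M, mult = mult M, one = one M, zero = zero M, add = add M,
      smult = (\<lambda>c m. const_xy c \<odot>\<^bsub>M\<^esub> m)\<rparr>"

definition coord_space :: "complex poly poly set \<Rightarrow> (complex, complex poly poly set) module" where
  "coord_space I = over_C (quot_module I)"

definition normal_space ::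
    "complex poly poly set \<Rightarrow> (complex, complex poly poly \<Rightarrow> complex poly poly set) module" where
  "normal_space I = over_C (hom_module (ideal_module I) (quot_module I))"

text \<open>
  A closed subscheme of the affine plane is given by its ideal.  Finite dimensionality has to be
  demanded separately since \<open>vectorspace.dim\<close> is unspecified otherwise.
\<close>

definition closed_subscheme_of_length :: "nat \<Rightarrow> complex poly poly set \<Rightarrow> bool" where
  "closed_subscheme_of_length n I \<longleftrightarrow>
     ideal I CXY \<and> vectorspace.fin_dim CC (coord_space I) \<and> vectorspace.dim CC (coord_space I) = n"

definition supported_at_origin :: "complex poly poly set \<Rightarrow> bool" where
  "supported_at_origin I \<longleftrightarrow> {(a, b). \<forall>f\<in>I. eval_xy f a b = 0} \<subseteq> {(0, 0)}"

definition monomial_ideal :: "complex poly poly set \<Rightarrow> bool" where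
  "monomial_ideal I \<longleftrightarrow>
     (\<exists>E :: (nat \<times> nat) set. I = Idl\<^bsub>CXY\<^esub> ((\<lambda>(i, j). monomial_xy i j) ` E))"

text \<open>
  The pair \<open>(U, V)\<close> stands for the derivation \<open>U \<partial>/\<partial>x + V \<partial>/\<partial>y\<close> along \<open>\<xi>\<close>; it is sent to
  \<open>f \<mapsto> U \<cdot> (\<partial>f/\<partial>x)|\<^sub>\<xi> + V \<cdot> (\<partial>f/\<partial>y)|\<^sub>\<xi>\<close>.
\<close>

definition alpha_fiber ::
    "complex poly poly set \<Rightarrow> complex poly poly set \<times> complex poly poly set
      \<Rightarrow> complex poly poly \<Rightarrow> complex poly poly set" where
  "alpha_fiber I = (\<lambda>(U, V). \<lambda>f\<in>I.
     (U \<otimes>\<^bsub>CXY Quot I\<^esub> residue_class I (dx f)) \<oplus>\<^bsub>CXY Quot I\<^esub> (V \<otimes>\<^bsub>CXY Quot I\<^esub> residue_class I (dy f)))"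

definition linear_rank ::
    "('a, 'k) ring_scheme \<Rightarrow> ('a, 'v, 'c) module_scheme \<Rightarrow> ('a, 'w, 'd) module_scheme
      \<Rightarrow> ('v \<Rightarrow> 'w) \<Rightarrow> nat" where
  "linear_rank K V W T = vectorspace.dim K (W\<lparr>carrier := T ` carrier V\<rparr>)"

definition rank_alpha :: "complex poly poly set \<Rightarrow> nat" where
  "rank_alpha I =
     linear_rank CC (direct_sum (coord_space I) (coord_space I)) (normal_space I) (alpha_fiber I)"

definition young_diagram :: "complex poly poly set \<Rightarrow> (nat \<times> nat) set" where
  "young_diagram I = {(i, j). monomial_xy i j \<notin> I}"

text \<open>
  The outer corners of a diagram are the exponents of the minimal monomial generators of the
  ideal: the minimal elements of the complement in the componentwise order.
\<close>

definition outer_corners :: "(nat \<times> nat) set \<Rightarrow> (nat \<times> nat) set" where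
  "outer_corners \<mu> =
     {(a, b). (a, b) \<notin> \<mu> \<and> (\<forall>a' b'. (a', b') \<notin> \<mu> \<and> a' \<le> a \<and> b' \<le> b \<longrightarrow> a' = a \<and> b' = b)}"

definition gaps :: "nat list \<Rightarrow> nat list" where
  "gaps xs = map2 (\<lambda>p q. q - p) xs (tl xs)"

definition horizontal_steps :: "(nat \<times> nat) set \<Rightarrow> nat list" where
  "horizontal_steps \<mu> = gaps (sorted_list_of_set (fst ` outer_corners \<mu>))"

text \<open>The perimeter is traced downwards, so the vertical steps run from high to low \<open>y\<close>.\<close>

definition vertical_steps :: "(nat \<times> nat) set \<Rightarrow> nat list" where
  "vertical_steps \<mu> = rev (gaps (sorted_list_of_set (snd ` outer_corners \<mu>)))"

text \<open>
  The records above are indeed modules and vector spaces, and \<^const>\<open>alpha_fiber\<close> is a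
  well-defined linear map, so that \<^const>\<open>rank_alpha\<close> is a genuine dimension.
\<close>

lemma cring_CXY: "cring CXY" by (rule class_cring.cring_axioms)

lemma module_quot: assumes "ideal I CXY" shows "Module.module CXY (quot_module I)"
proof -
  interpret ideal I CXY by fact
  interpret Q: cring "CXY Quot I" by (rule quotient_is_cring[OF cring_CXY])
  interpret h: ring_hom_ring CXY "CXY Quot I" "(+>\<^bsub>CXY\<^esub>) I" by (rule rcos_ring_hom_ring)
  have cl: "residue_class I r \<in> carrier (CXY Quot I)" for r using h.hom_closed[of r] by simp
  show ?thesis
  proof (rule moduleI[OF cring_CXY])
    show "abelian_group (quot_module I)"
      by (rule abelian_groupI) (auto simp: quot_module_def Q.a_ac intro: Q.add.l_inv_ex)
  qed (use h.hom_add h.hom_mult h.hom_one in \<open>auto simp: quot_module_def cl Q.l_distr Q.r_distr Q.m_assoc\<close>)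
qed

lemma module_ideal: assumes "ideal I CXY" shows "Module.module CXY (ideal_module I)"
proof -
  interpret ideal I CXY by fact
  have neg: "- x \<in> I" if "x \<in> I" for x
    using a_inv_closed[OF that] by (simp add: class_ring_simps)
  show ?thesis
  proof (rule moduleI[OF cring_CXY])
    show "abelian_group (ideal_module I)"
      apply (rule abelian_groupI)
      using a_closed additive_subgroup.zero_closed[OF is_additive_subgroup]
           apply (auto simp: ideal_module_def algebra_simps)
      using neg by force
  next
    fix a x assume "x \<in> carrier (ideal_module I)"
    then show "a \<odot>\<^bsub>ideal_module I\<^esub> x \<in> carrier (ideal_module I)"
      using I_l_closed[of x a] by (simp add: ideal_module_def)
  qed (auto simp: ideal_module_def algebra_simps)
qed

lemma module_hom_module:
  assumes "Module.module CXY M" "Module.module CXY N"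
  shows "Module.module CXY (hom_module M N)"
proof -
  interpret M: Module.module CXY M by fact
  interpret N: Module.module CXY N by fact
  have sm: "(a + b) \<odot>\<^bsub>N\<^esub> x = a \<odot>\<^bsub>N\<^esub> x \<oplus>\<^bsub>N\<^esub> b \<odot>\<^bsub>N\<^esub> x" "(a * b) \<odot>\<^bsub>N\<^esub> x = a \<odot>\<^bsub>N\<^esub> (b \<odot>\<^bsub>N\<^esub> x)"
      "1 \<odot>\<^bsub>N\<^esub> x = x" if "x \<in> carrier N" for a b x
    using N.smult_l_distr[OF _ _ that, of a b] N.smult_assoc1[OF _ _ that, of a b] N.smult_one[OF that]
    by simp_all
  have lc: "a \<odot>\<^bsub>N\<^esub> (b \<odot>\<^bsub>N\<^esub> x) = b \<odot>\<^bsub>N\<^esub> (a \<odot>\<^bsub>N\<^esub> x)" if "x \<in> carrier N" for a b x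
    using sm(2)[OF that, of a b] sm(2)[OF that, of b a] by (simp add: mult.commute)
  note d = hom_module_def LinearCombinations.module_hom_def
  show ?thesis
  proof (rule moduleI[OF cring_CXY])
    show "abelian_group (hom_module M N)"
    proof (rule abelian_groupI)
      fix x assume x: "x \<in> carrier (hom_module M N)"
      show "\<exists>y\<in>carrier (hom_module M N). y \<oplus>\<^bsub>hom_module M N\<^esub> x = \<zero>\<^bsub>hom_module M N\<^esub>"
        by (rule bexI[of _ "\<lambda>m\<in>carrier M. \<ominus>\<^bsub>N\<^esub> x m"])
           (use x in \<open>auto simp: d N.l_neg Pi_iff N.minus_add N.smult_r_minus intro!: restrict_ext\<close>)
    qed (auto simp: d Pi_iff N.a_ac N.smult_r_distr fun_eq_iff restrict_def extensional_def)
  next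
    fix a x assume "x \<in> carrier (hom_module M N)"
    then show "a \<odot>\<^bsub>hom_module M N\<^esub> x \<in> carrier (hom_module M N)"
      by (simp add: d Pi_iff N.smult_r_distr lc)
  next
    fix a b x assume "x \<in> carrier (hom_module M N)"
    then show "(a \<oplus>\<^bsub>CXY\<^esub> b) \<odot>\<^bsub>hom_module M N\<^esub> x = a \<odot>\<^bsub>hom_module M N\<^esub> x \<oplus>\<^bsub>hom_module M N\<^esub> b \<odot>\<^bsub>hom_module M N\<^esub> x"
      by (auto simp: d Pi_iff sm intro!: restrict_ext)
    show "(a \<otimes>\<^bsub>CXY\<^esub> b) \<odot>\<^bsub>hom_module M N\<^esub> x = a \<odot>\<^bsub>hom_module M N\<^esub> (b \<odot>\<^bsub>hom_module M N\<^esub> x)"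
      using \<open>x \<in> carrier (hom_module M N)\<close> by (auto simp: d Pi_iff sm intro!: restrict_ext)
    show "\<one>\<^bsub>CXY\<^esub> \<odot>\<^bsub>hom_module M N\<^esub> x = x"
      using \<open>x \<in> carrier (hom_module M N)\<close> by (auto simp: d Pi_iff sm restrict_def extensional_def fun_eq_iff)
  next
    fix a x y assume "x \<in> carrier (hom_module M N)" "y \<in> carrier (hom_module M N)"
    then show "a \<odot>\<^bsub>hom_module M N\<^esub> (x \<oplus>\<^bsub>hom_module M N\<^esub> y) = a \<odot>\<^bsub>hom_module M N\<^esub> x \<oplus>\<^bsub>hom_module M N\<^esub> a \<odot>\<^bsub>hom_module M N\<^esub> y"
      by (auto simp: d Pi_iff N.smult_r_distr intro!: restrict_ext)
  qed
qed

lemma vectorspace_over_C: assumes "Module.module CXY M" shows "vectorspace CC (over_C M)"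
proof -
  interpret M: Module.module CXY M by fact
  have cc: "cring CC" by (rule class_cring.cring_axioms)
  have "Module.module CC (over_C M)"
  proof (rule moduleI[OF cc])
    show "abelian_group (over_C M)"
      by (rule abelian_groupI) (auto simp: over_C_def M.a_ac intro: M.add.l_inv_ex)
  next
    fix a b x assume "x \<in> carrier (over_C M)"
    then have x: "x \<in> carrier M" by (simp add: over_C_def)
    show "(a \<oplus>\<^bsub>CC\<^esub> b) \<odot>\<^bsub>over_C M\<^esub> x = a \<odot>\<^bsub>over_C M\<^esub> x \<oplus>\<^bsub>over_C M\<^esub> b \<odot>\<^bsub>over_C M\<^esub> x"
      using M.smult_l_distr[of "const_xy a" "const_xy b" x] x by (simp add: over_C_def)
    show "(a \<otimes>\<^bsub>CC\<^esub> b) \<odot>\<^bsub>over_C M\<^esub> x = a \<odot>\<^bsub>over_C M\<^esub> (b \<odot>\<^bsub>over_C M\<^esub> x)"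
      using M.smult_assoc1[of "const_xy a" "const_xy b" x] x by (simp add: over_C_def)
    show "\<one>\<^bsub>CC\<^esub> \<odot>\<^bsub>over_C M\<^esub> x = x"
      using M.smult_one[of x] x by (simp add: over_C_def pCons_one)
  qed (simp_all add: over_C_def M.smult_r_distr)
  then show ?thesis
    by (simp add: vectorspace_def class_field.field_axioms)
qed

lemma dx_simps: "dx (f + g) = dx f + dx g" "dx (f * g) = dx f * g + f * dx g"
proof -
  have c: "coeff (dx f) i = pderiv (coeff f i)" for f i by (simp add: dx_def coeff_map_poly)
  show "dx (f + g) = dx f + dx g" by (rule poly_eqI) (simp add: c pderiv_add)
  have s: "pderiv (sum h A) = (\<Sum>a\<in>A. pderiv (h a))" for h :: "nat \<Rightarrow> complex poly" and A
    using higher_pderiv_sum[of 1 h A] by simp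
  show "dx (f * g) = dx f * g + f * dx g"
    by (rule poly_eqI) (simp only: coeff_add coeff_mult c s pderiv_mult sum.distrib, simp only: ac_simps)
qed

lemma alpha_fiber_linear:
  assumes "ideal I CXY"
  shows "linear_map CC (direct_sum (coord_space I) (coord_space I)) (normal_space I) (alpha_fiber I)"
proof -
  interpret ideal I CXY by fact
  interpret h: ring_hom_ring CXY "CXY Quot I" "(+>\<^bsub>CXY\<^esub>) I" by (rule rcos_ring_hom_ring)
  have cl: "residue_class I r \<in> carrier (CXY Quot I)" for r using h.hom_closed[of r] by simp
  have ad: "residue_class I (a + b) = residue_class I a \<oplus>\<^bsub>CXY Quot I\<^esub> residue_class I b" for a b
    using h.hom_add[of a b] by simp
  have mu: "residue_class I (a * b) = residue_class I a \<otimes>\<^bsub>CXY Quot I\<^esub> residue_class I b" for a b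
    using h.hom_mult[of a b] by simp
  have z: "residue_class I a = \<zero>\<^bsub>CXY Quot I\<^esub>" if "a \<in> I" for a
    using a_rcos_const[OF that] by (simp add: FactRing_def)
  have sums: "a + b \<in> I" if "a \<in> I" "b \<in> I" for a b using a_closed[OF that] by simp
  have prods: "a * b \<in> I" if "b \<in> I" for a b using I_l_closed[OF that] by simp
  have dys: "dy (f + g) = dy f + dy g" "dy (f * g) = dy f * g + f * dy g" for f g
    by (simp_all add: dy_def pderiv_add pderiv_mult algebra_simps)
  have V: "vectorspace CC (coord_space I)"
    unfolding coord_space_def by (rule vectorspace_over_C[OF module_quot[OF assms]])
  have W: "vectorspace CC (normal_space I)"
    unfolding normal_space_def
    by (intro vectorspace_over_C module_hom_module module_quot module_ideal assms)
  define Q where "Q = CXY Quot I"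
  interpret Q: cring Q unfolding Q_def by (rule quotient_is_cring[OF cring_CXY])
  note cl = cl[folded Q_def] and ad = ad[folded Q_def] and mu = mu[folded Q_def] and z = z[folded Q_def]
  have rdx: "residue_class I (dx (r * f)) = residue_class I r \<otimes>\<^bsub>Q\<^esub> residue_class I (dx f)"
    and rdy: "residue_class I (dy (r * f)) = residue_class I r \<otimes>\<^bsub>Q\<^esub> residue_class I (dy f)"
    if "f \<in> I" for r f
    by (simp_all only: dx_simps dys ad mu z[OF that] Q.r_null Q.l_zero Q.m_closed cl)
  have A: "U \<otimes>\<^bsub>Q\<^esub> (a \<oplus>\<^bsub>Q\<^esub> b) \<oplus>\<^bsub>Q\<^esub> V \<otimes>\<^bsub>Q\<^esub> (c \<oplus>\<^bsub>Q\<^esub> d)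
      = (U \<otimes>\<^bsub>Q\<^esub> a \<oplus>\<^bsub>Q\<^esub> V \<otimes>\<^bsub>Q\<^esub> c) \<oplus>\<^bsub>Q\<^esub> (U \<otimes>\<^bsub>Q\<^esub> b \<oplus>\<^bsub>Q\<^esub> V \<otimes>\<^bsub>Q\<^esub> d)"
    and B: "U \<otimes>\<^bsub>Q\<^esub> (a \<otimes>\<^bsub>Q\<^esub> b) \<oplus>\<^bsub>Q\<^esub> V \<otimes>\<^bsub>Q\<^esub> (a \<otimes>\<^bsub>Q\<^esub> c) = a \<otimes>\<^bsub>Q\<^esub> (U \<otimes>\<^bsub>Q\<^esub> b \<oplus>\<^bsub>Q\<^esub> V \<otimes>\<^bsub>Q\<^esub> c)"
    and C: "(U \<oplus>\<^bsub>Q\<^esub> a) \<otimes>\<^bsub>Q\<^esub> c \<oplus>\<^bsub>Q\<^esub> (V \<oplus>\<^bsub>Q\<^esub> b) \<otimes>\<^bsub>Q\<^esub> d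
      = (U \<otimes>\<^bsub>Q\<^esub> c \<oplus>\<^bsub>Q\<^esub> V \<otimes>\<^bsub>Q\<^esub> d) \<oplus>\<^bsub>Q\<^esub> (a \<otimes>\<^bsub>Q\<^esub> c \<oplus>\<^bsub>Q\<^esub> b \<otimes>\<^bsub>Q\<^esub> d)"
    and D: "(a \<otimes>\<^bsub>Q\<^esub> U) \<otimes>\<^bsub>Q\<^esub> c \<oplus>\<^bsub>Q\<^esub> (a \<otimes>\<^bsub>Q\<^esub> V) \<otimes>\<^bsub>Q\<^esub> d = a \<otimes>\<^bsub>Q\<^esub> (U \<otimes>\<^bsub>Q\<^esub> c \<oplus>\<^bsub>Q\<^esub> V \<otimes>\<^bsub>Q\<^esub> d)"
    if "U \<in> carrier Q" "V \<in> carrier Q" "a \<in> carrier Q" "b \<in> carrier Q" "c \<in> carrier Q" "d \<in> carrier Q"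
    for U V a b c d
    using that by (simp_all add: Q.r_distr Q.l_distr Q.a_ac Q.m_ac)
  note simps = direct_sum_def coord_space_def normal_space_def over_C_def hom_module_def quot_module_def
    ideal_module_def alpha_fiber_def Q_def[symmetric]
  have "alpha_fiber I \<in> LinearCombinations.module_hom CC
      (direct_sum (coord_space I) (coord_space I)) (normal_space I)"
    unfolding LinearCombinations.module_hom_def mem_Collect_eq
  proof (intro conjI allI impI funcsetI)
    fix p assume p: "p \<in> carrier (direct_sum (coord_space I) (coord_space I))"
    obtain U V where UV: "p = (U, V)" by (cases p)
    have U: "U \<in> carrier Q" "V \<in> carrier Q" using p by (simp_all add: UV simps)
    show "alpha_fiber I p \<in> carrier (normal_space I)"
      using U by (auto simp: UV simps LinearCombinations.module_hom_def cl rdx rdy dx_simps(1) dys(1) ad sums prods A B)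
  next
    fix p q assume "p \<in> carrier (direct_sum (coord_space I) (coord_space I)) \<and>
      q \<in> carrier (direct_sum (coord_space I) (coord_space I))"
    moreover obtain U V U' V' where "p = (U, V)" "q = (U', V')" by (cases p, cases q)
    ultimately show "alpha_fiber I (p \<oplus>\<^bsub>direct_sum (coord_space I) (coord_space I)\<^esub> q)
        = alpha_fiber I p \<oplus>\<^bsub>normal_space I\<^esub> alpha_fiber I q"
      by (auto simp: simps cl C intro!: restrict_ext)
  next
    fix c p assume "c \<in> carrier CC \<and> p \<in> carrier (direct_sum (coord_space I) (coord_space I))"
    moreover obtain U V where "p = (U, V)" by (cases p)
    ultimately show "alpha_fiber I (c \<odot>\<^bsub>direct_sum (coord_space I) (coord_space I)\<^esub> p)
        = c \<odot>\<^bsub>normal_space I\<^esub> alpha_fiber I p"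
      by (auto simp: simps cl D intro!: restrict_ext)
  qed
  with V W show ?thesis
    using direct_sum_is_vs[OF V V]
    by (intro linear_map.intro mod_hom.intro mod_hom_axioms.intro) (simp_all only: vectorspace_def)
qed

text \<open>The diagram of \<open>(y\<^sup>4, x\<^sup>2y\<^sup>2, x\<^sup>3y, x\<^sup>7)\<close>.\<close>

lemma sorted_0237: "sorted_list_of_set {0, 2, 3, 7::nat} = [0, 2, 3, 7]" 
  using sorted_list_of_set_sort_remdups[of "[0,2,3,7::nat]"] by simp
lemma sorted_0124: "sorted_list_of_set {4, 2, 1, 0::nat} = [0, 1, 2, 4]"
  using sorted_list_of_set_sort_remdups[of "[4,2,1,0::nat]"] by simp
lemma steps_example:
  fixes \<mu> :: "(nat \<times> nat) set"
  assumes \<mu>: "\<And>i j. (i, j) \<in> \<mu> \<longleftrightarrow> \<not> (j \<ge> 4 \<or> (i \<ge> 2 \<and> j \<ge> 2) \<or> (i \<ge> 3 \<and> j \<ge> 1) \<or> i \<ge> 7)"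
  shows "horizontal_steps \<mu> = [2, 1, 4]" and "vertical_steps \<mu> = [2, 1, 1]"
proof -
  have "outer_corners \<mu> = {(0, 4), (2, 2), (3, 1), (7, 0)}" (is "?L = ?R")
  proof (rule antisym)
    show "?L \<subseteq> ?R"
    proof (rule subrelI)
      fix a b assume "(a, b) \<in> outer_corners \<mu>"
      then have ab: "(a, b) \<notin> \<mu>" and min: "\<And>c d. (c, d) \<notin> \<mu> \<Longrightarrow> c \<le> a \<Longrightarrow> d \<le> b \<Longrightarrow> c = a \<and> d = b"
        by (auto simp: outer_corners_def)
      from ab consider "4 \<le> b" | "2 \<le> a" "2 \<le> b" | "3 \<le> a" "1 \<le> b" | "7 \<le> a"
        unfolding \<mu> by blast
      then show "(a, b) \<in> ?R"
      proof cases
        case 1 then show ?thesis using min[of 0 4] by (simp add: \<mu>)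
      next
        case 2 then show ?thesis using min[of 2 2] by (simp add: \<mu>)
      next
        case 3 then show ?thesis using min[of 3 1] by (simp add: \<mu>)
      next
        case 4 then show ?thesis using min[of 7 0] by (simp add: \<mu>)
      qed
    qed
  next
    show "?R \<subseteq> ?L" unfolding outer_corners_def \<mu> insert_subset mem_Collect_eq prod.case
      by (intro conjI allI impI empty_subsetI) presburger+
  qed
  then show "horizontal_steps \<mu> = [2, 1, 4]" and "vertical_steps \<mu> = [2, 1, 1]"
    by (simp_all add: horizontal_steps_def vertical_steps_def gaps_def sorted_0237 sorted_0124)
qed

end

theory Submission
  imports Defs
begin

text \<open>
  Let \<open>S\<close> be the set of exponents of monomials in \<open>I\<close>; a polynomial lies in \<open>I\<close> iff its support lies
  in \<open>S\<close>.  If \<open>m\<close> is the largest vertical step, then \<open>(a + 1, b) \<in> S\<close> implies \<open>(a, b + m) \<in> S\<close>, so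
  both \<open>x \<partial>/\<partial>x\<close> and \<open>y\<^sup>m \<partial>/\<partial>x\<close> map \<open>I\<close> into itself; symmetrically for \<open>\<partial>/\<partial>y\<close> and the largest
  horizontal step \<open>h\<close>.  Hence the image of \<open>\<alpha>\<close> is spanned by the images of \<open>y\<^sup>s \<partial>/\<partial>x\<close> for \<open>s < m\<close> and
  \<open>x\<^sup>r \<partial>/\<partial>y\<close> for \<open>r < h\<close>.  These are linearly independent: the first family is detected on a
  generator \<open>x\<^sup>a\<^sup>+\<^sup>1 y\<^sup>b\<close> at the foot of a vertical step of length \<open>m\<close>, where \<open>(a, b + s) \<notin> S\<close> for
  \<open>s < m\<close> and the terms coming from \<open>\<partial>/\<partial>y\<close> still have \<open>x\<close>-degree above \<open>a\<close>, and the second family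
  likewise.
\<close>

subsection \<open>Steps of a diagram\<close>

text \<open>Describes the gaps without reference to positions in the list, so that steps can be
  found from a set of coordinates alone. In the induction, a new least entry \<open>x\<close> adds
  exactly one pair of neighbours, namely \<open>x\<close> and the head \<open>y\<close> of the
  tail.\<close>

lemma set_gaps_strict_sorted:
  assumes "sorted_wrt (<) xs"
  shows "set (gaps xs) = {q - p | p q. p \<in> set xs \<and> q \<in> set xs \<and> p < q \<and> set xs \<inter> {p<..<q} = {}}"
  using assms
proof (induction xs)
  case Nil
  then show ?case by (simp add: gaps_def)
next
  case (Cons x xs)
  show ?case
  proof (cases xs)
    case Nil
    then show ?thesis by (auto simp: gaps_def)
  next
    case (Cons y ys)
    let ?C = "\<lambda>F p q. p \<in> F \<and> q \<in> F \<and> p < q \<and> F \<inter> {p<..<q} = {}"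
    from Cons Cons.prems have lt: "\<And>z. z \<in> set xs \<Longrightarrow> x < z" "\<And>z. z \<in> set xs \<Longrightarrow> y \<le> z"
      "y \<in> set xs" by auto
    have "?C (set (x # xs)) p q \<longleftrightarrow> (p = x \<and> q = y) \<or> ?C (set xs) p q" for p q
    proof (cases "p = x")
      case True
      show ?thesis
      proof
        assume C: "?C (set (x # xs)) p q"
        then have "q \<in> set xs" using True by auto
        then have "y \<le> q" by (rule lt)
        moreover have "\<not> y < q" using C lt(1)[OF lt(3)] lt(3) True by auto
        ultimately show "(p = x \<and> q = y) \<or> ?C (set xs) p q" using True by simp
      next
        assume "(p = x \<and> q = y) \<or> ?C (set xs) p q"
        with True lt show "?C (set (x # xs)) p q" by fastforce
      qed
    next
      case False
      with lt show ?thesis by fastforce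
    qed
    then have "{q - p | p q. ?C (set (x # xs)) p q} = insert (y - x) {q - p | p q. ?C (set xs) p q}"
      by auto
    also have "{q - p | p q. ?C (set xs) p q} = set (gaps xs)"
      using Cons.IH Cons.prems by simp
    also have "insert (y - x) (set (gaps xs)) = set (gaps (x # xs))"
      by (simp add: Cons gaps_def)
    finally show ?thesis ..
  qed
qed

lemma set_gaps_sorted_list_of_set:
  assumes "finite F"
  shows "set (gaps (sorted_list_of_set F)) =
    {q - p | p q. p \<in> F \<and> q \<in> F \<and> p < q \<and> F \<inter> {p<..<q} = {}}"
  using set_gaps_strict_sorted[of "sorted_list_of_set F"] assms by simp

section \<open>Column heights of a bounded Young diagram\<close>

text \<open>Separates the combinatorics from the ideal. The bounds \<open>A\<close> and
  \<open>B\<close> confine the diagram to a box, and \<open>origin\<close> makes it nonempty, so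
  that there is at least one step of each kind.\<close>

locale bounded_diagram =
  fixes \<mu> :: "(nat \<times> nat) set" and A B :: nat
  assumes down: "(i, j) \<in> \<mu> \<Longrightarrow> i' \<le> i \<Longrightarrow> j' \<le> j \<Longrightarrow> (i', j') \<in> \<mu>"
    and origin: "(0, 0) \<in> \<mu>"
    and bound_x: "(A, 0) \<notin> \<mu>"
    and bound_y: "(0, B) \<notin> \<mu>"
begin

text \<open>Number of boxes in column \<open>a\<close>. By \<open>bound_y\<close> the set under
  \<open>LEAST\<close> is never empty.\<close>

definition height :: "nat \<Rightarrow> nat" where
  "height a = (LEAST b. (a, b) \<notin> \<mu>)"

lemma in_diagram_iff: "(a, b) \<in> \<mu> \<longleftrightarrow> b < height a"
proof -
  have "(a, B) \<notin> \<mu>" using bound_y down by blast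
  then have "(a, height a) \<notin> \<mu>" unfolding height_def by (rule LeastI)
  then show ?thesis
    unfolding height_def using down not_less_Least by (metis le_refl not_le)
qed

lemma height_antimono: "a \<le> a' \<Longrightarrow> height a' \<le> height a"
  using down in_diagram_iff by (metis le_refl less_irrefl not_le)

text \<open>A corner sits on top of its column, so its second coordinate is a height. Conversely,
  each height is attained first in some leftmost column, and the point on top of that column is
  minimal. Vertical steps thus become differences of neighbouring values of
  \<open>height\<close>.\<close>

lemma snd_outer_corners: "snd ` outer_corners \<mu> = range height"
proof (intro equalityI subsetI)
  fix b assume "b \<in> snd ` outer_corners \<mu>"
  then obtain a where "(a, b) \<in> outer_corners \<mu>" by force
  then have "(a, b) \<notin> \<mu>" "\<And>a' b'. (a', b') \<notin> \<mu> \<Longrightarrow> a' \<le> a \<Longrightarrow> b' \<le> b \<Longrightarrow> a' = a \<and> b' = b"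
    by (auto simp: outer_corners_def)
  then have "b = height a"
    by (metis in_diagram_iff le_refl less_irrefl not_less)
  then show "b \<in> range height" by simp
next
  fix b assume "b \<in> range height"
  then obtain a0 where "height a0 = b" by auto
  define a where "a = (LEAST a. height a = b)"
  have a: "height a = b"
    unfolding a_def by (rule LeastI) fact
  have "a' = a \<and> b' = b" if "(a', b') \<notin> \<mu>" "a' \<le> a" "b' \<le> b" for a' b'
  proof -
    have "height a' \<le> b'" using that in_diagram_iff by (meson not_less)
    with height_antimono[OF that(2)] a that(3) have "height a' = b" "b' = b" by auto
    then show ?thesis using that(2) Least_le[of "\<lambda>a. height a = b" a'] by (simp add: a_def)
  qed
  moreover have "(a, b) \<notin> \<mu>" using a in_diagram_iff by simp
  ultimately have "(a, b) \<in> outer_corners \<mu>" by (auto simp: outer_corners_def)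
  then show "b \<in> snd ` outer_corners \<mu>" by force
qed

lemma finite_range_height: "finite (range height)"
  by (rule finite_subset[of _ "{..height 0}"]) (auto intro: height_antimono)

lemma set_vertical_steps:
  "set (vertical_steps \<mu>) =
    {q - p | p q. p \<in> range height \<and> q \<in> range height \<and> p < q \<and> range height \<inter> {p<..<q} = {}}"
  by (simp add: vertical_steps_def snd_outer_corners set_gaps_sorted_list_of_set finite_range_height)

text \<open>Monotonicity leaves no height strictly between those of two adjacent columns, so the
  drop is a single step.\<close>

lemma height_drop_in_vertical_steps:
  assumes "height a \<noteq> height (Suc a)"
  shows "height a - height (Suc a) \<in> set (vertical_steps \<mu>)"
proof -
  have "height (Suc a) < height a" using assms height_antimono[of a "Suc a"] by simp
  moreover have "\<not> (height (Suc a) < height c \<and> height c < height a)" for c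
    using height_antimono[of c a] height_antimono[of "Suc a" c] by (cases "c \<le> a") auto
  then have "range height \<inter> {height (Suc a)<..<height a} = {}" by auto
  ultimately show ?thesis unfolding set_vertical_steps by blast
qed

lemma height_le_Suc_plus_Max: "height a \<le> height (Suc a) + Max (set (vertical_steps \<mu>))"
proof (cases "height a = height (Suc a)")
  case False
  then have "height a - height (Suc a) \<le> Max (set (vertical_steps \<mu>))"
    by (intro Max_ge height_drop_in_vertical_steps) simp_all
  then show ?thesis by simp
qed simp

text \<open>The drop between adjacent columns is at most the largest step. For monomials: one factor
  x may be traded for that many factors y without leaving the ideal.\<close>

lemma Max_vertical_steps_shift:
  assumes "(Suc a, b) \<notin> \<mu>"
  shows "(a, b + Max (set (vertical_steps \<mu>))) \<notin> \<mu>"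
  using assms height_le_Suc_plus_Max[of a] by (simp add: in_diagram_iff)

text \<open>Makes \<open>Max\<close> an actual step. Without steps the height would be constant, but
  it is positive at 0 and zero at \<open>A\<close>.\<close>

lemma vertical_steps_nonempty: "set (vertical_steps \<mu>) \<noteq> {}"
proof
  assume empty: "set (vertical_steps \<mu>) = {}"
  then have "height a = height (Suc a)" for a using height_drop_in_vertical_steps by fastforce
  then have "height a = height 0" for a by (induction a) auto
  then show False using origin bound_x in_diagram_iff by metis
qed

text \<open>Take neighbouring heights p < q with maximal difference and the leftmost column of
  height p. The column before it is taller than p, hence at least q high, since no height lies
  between.\<close>

lemma Max_vertical_steps_attained:
  obtains a b where "(Suc a, b) \<notin> \<mu>" "\<And>s. s < Max (set (vertical_steps \<mu>)) \<Longrightarrow> (a, b + s) \<in> \<mu>"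
proof -
  let ?M = "Max (set (vertical_steps \<mu>))"
  have "?M \<in> set (vertical_steps \<mu>)" using vertical_steps_nonempty by simp
  then obtain p q where pq: "?M = q - p" "p \<in> range height" "q \<in> range height" "p < q"
      "range height \<inter> {p<..<q} = {}"
    unfolding set_vertical_steps by blast
  define c where "c = (LEAST a. height a = p)"
  obtain a0 where "height a0 = p" using pq(2) by auto
  then have c: "height c = p" unfolding c_def by (rule LeastI)
  \<comment> \<open>Column 0 has the greatest height, and q > p is also a height.\<close>
  have "c \<noteq> 0"
    using pq(3,4) c height_antimono[of 0] by (metis imageE le0 not_less)
  then obtain a where a: "c = Suc a" by (cases c) auto
  have "height a \<noteq> p" using not_less_Least[of a "\<lambda>a. height a = p"] a by (simp add: c_def)
  moreover have "p \<le> height a" using height_antimono[of a c] a c by simp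
  moreover have "height a \<notin> {p<..<q}" using pq(5) by blast
  ultimately have "q \<le> height a" by auto
  show ?thesis
  proof (rule that[of a p])
    show "(Suc a, p) \<notin> \<mu>" using c a by (simp add: in_diagram_iff)
    show "(a, p + s) \<in> \<mu>" if "s < ?M" for s
      using that pq(1) \<open>q \<le> height a\<close> by (simp add: in_diagram_iff)
  qed
qed

end

section \<open>Reflection in the diagonal\<close>

lemma outer_corners_swap: "outer_corners (prod.swap ` \<mu>) = prod.swap ` outer_corners \<mu>"
proof -
  have swap: "(a, b) \<in> prod.swap ` X \<longleftrightarrow> (b, a) \<in> X" for a b and X :: "(nat \<times> nat) set" by force
  have "(a, b) \<in> outer_corners (prod.swap ` \<mu>) \<longleftrightarrow> (b, a) \<in> outer_corners \<mu>" for a b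
    unfolding outer_corners_def mem_Collect_eq prod.case swap by blast
  then show ?thesis unfolding set_eq_iff split_paired_All swap by blast
qed

text \<open>Transfers the results on vertical steps to horizontal ones. Only the sets are compared
  because \<open>vertical_steps\<close> reverses its list; this suffices for the maximum.\<close>

lemma set_vertical_steps_swap: "set (vertical_steps (prod.swap ` \<mu>)) = set (horizontal_steps \<mu>)"
  by (simp add: vertical_steps_def horizontal_steps_def outer_corners_swap image_image)

lemma (in bounded_diagram) bounded_diagram_swap: "bounded_diagram (prod.swap ` \<mu>) B A"
proof -
  have swap: "(a, b) \<in> prod.swap ` \<mu> \<longleftrightarrow> (b, a) \<in> \<mu>" for a b by force
  show ?thesis
    by unfold_locales (auto simp only: swap origin bound_x bound_y intro: down)
qed

subsection \<open>Monomial ideals of the polynomial ring\<close>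

text \<open>A nonzero convolution sum has a nonzero term; this is applied first in y, then in
  x.\<close>

lemma coeff_coeff_mult_nonzeroE:
  fixes p q :: "complex poly poly"
  assumes "coeff (coeff (p * q) j) i \<noteq> 0"
  obtains i1 j1 i2 j2 where "i = i1 + i2" "j = j1 + j2"
    "coeff (coeff p j1) i1 \<noteq> 0" "coeff (coeff q j2) i2 \<noteq> 0"
proof -
  have "coeff (coeff (p * q) j) i =
      (\<Sum>k\<le>j. \<Sum>l\<le>i. coeff (coeff p k) l * coeff (coeff q (j - k)) (i - l))"
    by (simp add: coeff_mult coeff_sum)
  with assms obtain k where k: "k \<le> j"
      "(\<Sum>l\<le>i. coeff (coeff p k) l * coeff (coeff q (j - k)) (i - l)) \<noteq> 0"
    by (metis (no_types, lifting) atMost_iff sum.not_neutral_contains_not_neutral)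
  then obtain l where "l \<le> i" "coeff (coeff p k) l * coeff (coeff q (j - k)) (i - l) \<noteq> 0"
    by (metis (no_types, lifting) atMost_iff sum.not_neutral_contains_not_neutral)
  with k(1) show ?thesis by (intro that[of l "i - l" k "j - k"]) auto
qed

lemma coeff_coeff_monomial_xy:
  "coeff (coeff (monomial_xy a b) j) i = (if a = i \<and> b = j then 1 else 0)"
  by (simp add: monomial_xy_def)

lemma monomial_xy_mult: "monomial_xy a b * monomial_xy c d = monomial_xy (a + c) (b + d)"
  by (simp add: monomial_xy_def mult_monom)

lemma coeff_coeff_dx: "coeff (coeff (dx f) j) i = of_nat (Suc i) * coeff (coeff f j) (Suc i)"
  by (simp add: dx_def coeff_map_poly coeff_pderiv)

lemma coeff_coeff_dy: "coeff (coeff (dy f) j) i = of_nat (Suc j) * coeff (coeff f (Suc j)) i"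
  by (simp add: dy_def coeff_pderiv of_nat_poly flip: of_nat_Suc)

lemma coeff_coeff_mult_monomial_xy:
  "coeff (coeff (f * monomial_xy a b) (b + j)) (a + i) = coeff (coeff f j) i"
  by (simp add: monomial_xy_def mult.commute[of f] coeff_monom_mult)

lemma coeff_coeff_const_mult: "coeff (coeff (const_xy c * f) j) i = c * coeff (coeff f j) i"
  by simp

text \<open>Multiplication by the derivative of a monomial only shifts and rescales, so coefficients
  of \<open>f\<close> can be read off the product. The factor \<open>Suc a\<close> is nonzero in
  characteristic zero.\<close>

lemma coeff_coeff_mult_dx_monomial_xy:
  "coeff (coeff (f * dx (monomial_xy (Suc a) b)) (b + j)) (a + i) = of_nat (Suc a) * coeff (coeff f j) i"
proof -
  have dx: "dx (monomial_xy (Suc a) b) = const_xy (of_nat (Suc a)) * monomial_xy a b"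
    by (intro poly_eqI) (simp only: coeff_coeff_dx coeff_coeff_const_mult coeff_coeff_monomial_xy, simp)
  show ?thesis
    unfolding dx mult.left_commute[of f] coeff_coeff_const_mult coeff_coeff_mult_monomial_xy ..
qed

lemma coeff_coeff_mult_dy_monomial_xy:
  "coeff (coeff (f * dy (monomial_xy a (Suc b))) (b + j)) (a + i) = of_nat (Suc b) * coeff (coeff f j) i"
proof -
  have dy: "dy (monomial_xy a (Suc b)) = const_xy (of_nat (Suc b)) * monomial_xy a b"
    by (intro poly_eqI) (simp only: coeff_coeff_dy coeff_coeff_const_mult coeff_coeff_monomial_xy, simp)
  show ?thesis
    unfolding dy mult.left_commute[of f] coeff_coeff_const_mult coeff_coeff_mult_monomial_xy ..
qed

lemma sum_monomial_xy:
  "f = (\<Sum>j\<le>degree f. \<Sum>i\<le>degree (coeff f j). const_xy (coeff (coeff f j) i) * monomial_xy i j)"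
proof -
  have "const_xy c * monomial_xy i j = monom (monom c i) j" for c i j
    by (simp add: monomial_xy_def smult_monom)
  then have "(\<Sum>j\<le>degree f. \<Sum>i\<le>degree (coeff f j). const_xy (coeff (coeff f j) i) * monomial_xy i j) =
      (\<Sum>j\<le>degree f. monom (\<Sum>i\<le>degree (coeff f j). monom (coeff (coeff f j) i) i) j)"
    by (simp add: monom_sum)
  also have "\<dots> = f" by (simp add: poly_as_sum_of_monoms)
  finally show ?thesis ..
qed

section \<open>Membership in an ideal tested on supports\<close>

locale plane_ideal =
  fixes I :: "complex poly poly set"
  assumes ideal_I: "ideal I CXY"
begin

sublocale ideal I CXY
  by (rule ideal_I)

lemma zero_mem: "0 \<in> I"
  using additive_subgroup.zero_closed[OF is_additive_subgroup] by simp

lemma add_mem: "f \<in> I \<Longrightarrow> g \<in> I \<Longrightarrow> f + g \<in> I"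
  using a_closed by simp

lemma mult_mem: "g \<in> I \<Longrightarrow> f * g \<in> I"
  using I_l_closed[of g f] by simp

lemma sum_mem: "(\<And>x. x \<in> X \<Longrightarrow> f x \<in> I) \<Longrightarrow> sum f X \<in> I"
  by (induction X rule: infinite_finite_induct) (auto intro: zero_mem add_mem)

lemma young_diagram_down:
  assumes "(i, j) \<in> young_diagram I" "i' \<le> i" "j' \<le> j"
  shows "(i', j') \<in> young_diagram I"
  using assms mult_mem[of "monomial_xy i' j'" "monomial_xy (i - i') (j - j')"]
  by (auto simp: young_diagram_def monomial_xy_mult)

text \<open>Valid for any ideal: \<open>f\<close> is a linear combination of monomials that all lie
  in \<open>I\<close>.\<close>

lemma memI:
  assumes "\<And>i j. coeff (coeff f j) i \<noteq> 0 \<Longrightarrow> (i, j) \<notin> young_diagram I"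
  shows "f \<in> I"
proof (subst sum_monomial_xy, intro sum_mem)
  fix i j
  show "const_xy (coeff (coeff f j) i) * monomial_xy i j \<in> I"
    using assms[of j i] zero_mem mult_mem[of "monomial_xy i j" "const_xy (coeff (coeff f j) i)"]
    by (cases "coeff (coeff f j) i = 0") (simp_all add: young_diagram_def)
qed

end

locale monomial_plane_ideal = plane_ideal +
  assumes monomial: "monomial_ideal I"
begin

text \<open>The converse of \<open>memI\<close>, where generation by monomials enters. The
  polynomials with support outside the diagram form an ideal \<open>J\<close>, because that
  complement is closed under adding exponents. \<open>J\<close> contains the generators, hence all
  of \<open>I\<close>.\<close>

lemma coeff_coeff_mem:
  assumes "f \<in> I" "coeff (coeff f j) i \<noteq> 0"
  shows "(i, j) \<notin> young_diagram I"
proof -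
  obtain E where E: "I = Idl\<^bsub>CXY\<^esub> ((\<lambda>(i, j). monomial_xy i j) ` E)"
    using monomial by (auto simp: monomial_ideal_def)
  define J :: "complex poly poly set" where "J = {f. \<forall>i j. coeff (coeff f j) i \<noteq> 0 \<longrightarrow> (i, j) \<notin> young_diagram I}"
  have mult: "f * g \<in> J" if "g \<in> J" for f g
    using that young_diagram_down unfolding J_def
    by (auto elim!: coeff_coeff_mult_nonzeroE) (meson le_add2)
  have "ideal J CXY"
  proof (rule idealI)
    show "ring CXY" by (rule class_ring.ring_axioms)
    show "subgroup J (add_monoid CXY)"
    proof (rule group.subgroupI)
      show "group (add_monoid CXY)" by (rule abelian_group.a_group) (rule class_ring.abelian_group_axioms)
      show "J \<noteq> {}" by (auto simp: J_def intro!: exI[of _ 0])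
      show "inv\<^bsub>add_monoid CXY\<^esub> f \<in> J" if "f \<in> J" for f
      proof -
        have "inv\<^bsub>add_monoid CXY\<^esub> f = - f"
          using class_ring_simps(8)[where 'a = "complex poly poly"] by (simp add: a_inv_def fun_eq_iff)
        then show ?thesis using that by (simp add: J_def)
      qed
      show "f \<otimes>\<^bsub>add_monoid CXY\<^esub> g \<in> J" if "f \<in> J" "g \<in> J" for f g
        using that by (auto simp: J_def) (metis add.right_neutral)
    qed simp
  qed (use mult in \<open>auto simp: mult.commute\<close>)
  moreover have "(\<lambda>(i, j). monomial_xy i j) ` E \<subseteq> J"
  proof -
    have "(\<lambda>(i, j). monomial_xy i j) ` E \<subseteq> I"
      unfolding E by (rule ring.genideal_self[OF class_ring.ring_axioms]) simp
    then show ?thesis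
      by (fastforce simp: J_def coeff_coeff_monomial_xy young_diagram_def split: if_splits)
  qed
  ultimately have "I \<subseteq> J"
    unfolding E by (rule ring.genideal_minimal[OF class_ring.ring_axioms])
  with assms show ?thesis by (auto simp: J_def)
qed

end


subsection \<open>The rank\<close>

context plane_ideal
begin

sublocale residue: ring_hom_ring CXY "CXY Quot I" "(+>\<^bsub>CXY\<^esub>) I"
  by (rule rcos_ring_hom_ring)

lemma residue_closed: "residue_class I f \<in> carrier (CXY Quot I)"
  using residue.hom_closed[of f] by simp

lemma residue_add: "residue_class I (f + g) = residue_class I f \<oplus>\<^bsub>CXY Quot I\<^esub> residue_class I g"
  using residue.hom_add[of f g] by simp

lemma residue_mult: "residue_class I (f * g) = residue_class I f \<otimes>\<^bsub>CXY Quot I\<^esub> residue_class I g"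
  using residue.hom_mult[of f g] by simp

lemma residue_eq_iff: "residue_class I f = residue_class I g \<longleftrightarrow> f - g \<in> I"
  using quotient_eq_iff_same_a_r_cos[OF ideal_I, of f g]
  by (simp add: class_ring_simps)

lemma carrier_quot: "carrier (CXY Quot I) = range (residue_class I)"
  by (auto simp: FactRing_def A_RCOSETS_def')

lemma alpha_fiber_residue:
  "alpha_fiber I (residue_class I u, residue_class I v) = (\<lambda>f\<in>I. residue_class I (u * dx f + v * dy f))"
  by (simp add: alpha_fiber_def residue_add residue_mult)

text \<open>Two derivations have the same image exactly when their difference maps \<open>I\<close>
  into itself. Both surjectivity and injectivity of the parametrisation below reduce to this
  criterion.\<close>

lemma alpha_fiber_residue_eq_iff:
  "alpha_fiber I (residue_class I u, residue_class I v) = alpha_fiber I (residue_class I u', residue_class I v')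
    \<longleftrightarrow> (\<forall>f\<in>I. (u - u') * dx f + (v - v') * dy f \<in> I)"
proof -
  have "(u * dx f + v * dy f) - (u' * dx f + v' * dy f) = (u - u') * dx f + (v - v') * dy f" for f
    by (simp add: algebra_simps)
  then show ?thesis
    by (simp add: alpha_fiber_residue restrict_def fun_eq_iff Ball_def flip: residue_eq_iff) (metis residue_eq_iff)
qed

end

text \<open>The coefficients are given by a function so that a segment of a vector, starting at any
  offset, can be inserted.\<close>

definition poly_y :: "nat \<Rightarrow> (nat \<Rightarrow> complex) \<Rightarrow> complex poly poly" where
  "poly_y m c = (\<Sum>s<m. const_xy (c s) * monomial_xy 0 s)"

definition poly_x :: "nat \<Rightarrow> (nat \<Rightarrow> complex) \<Rightarrow> complex poly poly" where
  "poly_x m c = (\<Sum>r<m. const_xy (c r) * monomial_xy r 0)"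

lemma coeff_coeff_poly_y: "coeff (coeff (poly_y m c) j) i = (if i = 0 \<and> j < m then c j else 0)"
proof -
  have "coeff (coeff (poly_y m c) j) i = (\<Sum>s<m. c s * (if 0 = i \<and> s = j then 1 else 0))"
    unfolding poly_y_def coeff_sum coeff_coeff_const_mult coeff_coeff_monomial_xy ..
  also have "\<dots> = (\<Sum>s<m. if s = j then (if i = 0 then c j else 0) else 0)"
    by (rule sum.cong) auto
  finally show ?thesis by (simp add: sum.delta)
qed

lemma coeff_coeff_poly_x: "coeff (coeff (poly_x m c) j) i = (if j = 0 \<and> i < m then c i else 0)"
proof -
  have "coeff (coeff (poly_x m c) j) i = (\<Sum>s<m. c s * (if s = i \<and> 0 = j then 1 else 0))"
    unfolding poly_x_def coeff_sum coeff_coeff_const_mult coeff_coeff_monomial_xy ..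
  also have "\<dots> = (\<Sum>s<m. if s = i then (if j = 0 then c i else 0) else 0)"
    by (rule sum.cong) auto
  finally show ?thesis by (simp add: sum.delta)
qed

lemma poly_xy_add:
  "poly_y m (\<lambda>s. c s + d s) = poly_y m c + poly_y m d"
  "poly_x m (\<lambda>s. c s + d s) = poly_x m c + poly_x m d"
  by (intro poly_eqI; simp add: coeff_coeff_poly_y coeff_coeff_poly_x)+

lemma poly_xy_scale:
  "poly_y m (\<lambda>s. a * c s) = const_xy a * poly_y m c"
  "poly_x m (\<lambda>s. a * c s) = const_xy a * poly_x m c"
  by (intro poly_eqI; simp add: coeff_coeff_poly_y coeff_coeff_poly_x)+

section \<open>Derivations that preserve the ideal\<close>

context monomial_plane_ideal
begin

text \<open>Every monomial of \<open>u\<close> is divisible by x or by y^m. A factor x restores the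
  exponent lost by differentiating; a factor y^m is covered by \<open>shift\<close>.\<close>

lemma mult_dx_mem:
  assumes shift: "\<And>a b. (Suc a, b) \<notin> young_diagram I \<Longrightarrow> (a, b + m) \<notin> young_diagram I"
    and u: "\<And>s. s < m \<Longrightarrow> coeff (coeff u s) 0 = 0" and f: "f \<in> I"
  shows "u * dx f \<in> I"
proof (rule memI)
  fix i j assume "coeff (coeff (u * dx f) j) i \<noteq> 0"
  then obtain i1 j1 i2 j2 where ij: "i = i1 + i2" "j = j1 + j2"
      and nz: "coeff (coeff u j1) i1 \<noteq> 0" "coeff (coeff (dx f) j2) i2 \<noteq> 0"
    by (rule coeff_coeff_mult_nonzeroE)
  \<comment> \<open>The monomial with exponents (i2, j2) in the derivative comes from one with
    x-exponent \<open>Suc i2\<close> in \<open>f\<close>.\<close>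
  from nz(2) have S: "(Suc i2, j2) \<notin> young_diagram I"
    by (intro coeff_coeff_mem[OF f]) (auto simp: coeff_coeff_dx)
  show "(i, j) \<notin> young_diagram I"
  proof (cases "i1 = 0")
    case True
    with nz(1) u have "m \<le> j1" by (meson not_less)
    then show ?thesis using shift[OF S] young_diagram_down ij True
      by (metis add.commute add_left_mono add_0 le_refl)
  next
    case False
    then show ?thesis using S young_diagram_down[of i j "Suc i2" j2] ij by auto
  qed
qed

text \<open>Mirror image of \<open>mult_dx_mem\<close>: every monomial of \<open>v\<close> is
  divisible by y or by x^m.\<close>

lemma mult_dy_mem:
  assumes shift: "\<And>a b. (a, Suc b) \<notin> young_diagram I \<Longrightarrow> (a + m, b) \<notin> young_diagram I"
    and v: "\<And>s. s < m \<Longrightarrow> coeff (coeff v 0) s = 0" and f: "f \<in> I"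
  shows "v * dy f \<in> I"
proof (rule memI)
  fix i j assume "coeff (coeff (v * dy f) j) i \<noteq> 0"
  then obtain i1 j1 i2 j2 where ij: "i = i1 + i2" "j = j1 + j2"
      and nz: "coeff (coeff v j1) i1 \<noteq> 0" "coeff (coeff (dy f) j2) i2 \<noteq> 0"
    by (rule coeff_coeff_mult_nonzeroE)
  from nz(2) have S: "(i2, Suc j2) \<notin> young_diagram I"
    by (intro coeff_coeff_mem[OF f]) (auto simp: coeff_coeff_dy)
  show "(i, j) \<notin> young_diagram I"
  proof (cases "j1 = 0")
    case True
    with nz(1) v have "m \<le> i1" by (meson not_less)
    then show ?thesis using shift[OF S] young_diagram_down ij True
      by (metis add.commute add_left_mono add_0 le_refl)
  next
    case False
    then show ?thesis using S young_diagram_down[of i j i2 "Suc j2"] ij by auto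
  qed
qed

end


section \<open>Monomial ideals supported at the origin\<close>

text \<open>The assumption \<open>proper\<close> says that 1 is not in \<open>I\<close>; it is the
  form in which positive length enters.\<close>

locale punctual_monomial_ideal = monomial_plane_ideal +
  assumes support: "supported_at_origin I"
    and proper: "monomial_xy 0 0 \<notin> I"
begin

text \<open>Otherwise no element of \<open>I\<close> has a pure power of x in its support, so all of
  \<open>I\<close> vanishes on the x-axis, in particular at (1, 0).\<close>

lemma pure_x_power_mem: "\<exists>A. (A, 0) \<notin> young_diagram I"
proof (rule ccontr)
  assume "\<nexists>A. (A, 0) \<notin> young_diagram I"
  then have "coeff f 0 = 0" if "f \<in> I" for f
    using coeff_coeff_mem[OF that] by (intro poly_eqI) (metis coeff_0)
  then have "(1, 0) \<in> {(a, b). \<forall>f\<in>I. eval_xy f a b = 0}"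
    by (simp add: eval_xy_def poly_0_coeff_0)
  with support have "(1::complex, 0::complex) \<in> {(0, 0)}"
    unfolding supported_at_origin_def by (rule subsetD)
  then show False by simp
qed

lemma pure_y_power_mem: "\<exists>B. (0, B) \<notin> young_diagram I"
proof (rule ccontr)
  assume "\<nexists>B. (0, B) \<notin> young_diagram I"
  then have c: "coeff (coeff f j) 0 = 0" if "f \<in> I" for f j
    using coeff_coeff_mem[OF that] by metis
  \<comment> \<open>At (0, 1) only the pure powers of y survive, each with value 1.\<close>
  have "eval_xy f 0 1 = (\<Sum>j\<le>degree f. coeff (coeff f j) 0)" for f
    unfolding eval_xy_def by (simp add: poly_altdef poly_0_coeff_0 coeff_sum flip: one_pCons)
  then have "(0, 1) \<in> {(a, b). \<forall>f\<in>I. eval_xy f a b = 0}"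
    by (simp add: c)
  with support have "(0::complex, 1::complex) \<in> {(0, 0)}"
    unfolding supported_at_origin_def by (rule subsetD)
  then show False by simp
qed

definition max_v :: nat where
  "max_v = Max (set (vertical_steps (young_diagram I)))"

definition max_h :: nat where
  "max_h = Max (set (horizontal_steps (young_diagram I)))"

lemma bounded_diagramE:
  obtains A B where "bounded_diagram (young_diagram I) A B"
proof -
  obtain A B where "(A, 0) \<notin> young_diagram I" "(0, B) \<notin> young_diagram I"
    using pure_x_power_mem pure_y_power_mem by blast
  moreover have "(0, 0) \<in> young_diagram I" using proper by (simp add: young_diagram_def)
  ultimately have "bounded_diagram (young_diagram I) A B"
    by unfold_locales (auto intro: young_diagram_down)
  then show ?thesis by (rule that)
qed

lemma max_v_shift: "(Suc a, b) \<notin> young_diagram I \<Longrightarrow> (a, b + max_v) \<notin> young_diagram I"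
  unfolding max_v_def by (rule bounded_diagramE) (rule bounded_diagram.Max_vertical_steps_shift)

lemma max_v_attained:
  obtains a b where "(Suc a, b) \<notin> young_diagram I" "\<And>s. s < max_v \<Longrightarrow> (a, b + s) \<in> young_diagram I"
proof -
  obtain A B where "bounded_diagram (young_diagram I) A B" by (rule bounded_diagramE)
  then show ?thesis
    by (rule bounded_diagram.Max_vertical_steps_attained) (auto simp: max_v_def intro: that)
qed

lemma mem_swap: "(a, b) \<in> prod.swap ` young_diagram I \<longleftrightarrow> (b, a) \<in> young_diagram I"
  by force

lemma max_h_shift: "(a, Suc b) \<notin> young_diagram I \<Longrightarrow> (a + max_h, b) \<notin> young_diagram I"
proof (rule bounded_diagramE)
  fix A B assume "(a, Suc b) \<notin> young_diagram I" "bounded_diagram (young_diagram I) A B"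
  then show ?thesis
    \<comment> \<open>The vertical statement for the transposed diagram, hence the order
      \<open>b a\<close>.\<close>
    using bounded_diagram.Max_vertical_steps_shift[OF bounded_diagram.bounded_diagram_swap, of "young_diagram I" A B b a]
    by (simp add: mem_swap set_vertical_steps_swap max_h_def)
qed

lemma max_h_attained:
  obtains a b where "(a, Suc b) \<notin> young_diagram I" "\<And>s. s < max_h \<Longrightarrow> (a + s, b) \<in> young_diagram I"
proof -
  obtain A B where "bounded_diagram (young_diagram I) A B" by (rule bounded_diagramE)
  then have "bounded_diagram (prod.swap ` young_diagram I) B A" by (rule bounded_diagram.bounded_diagram_swap)
  then obtain b a where "(Suc b, a) \<notin> prod.swap ` young_diagram I"
      "\<And>s. s < max_h \<Longrightarrow> (b, a + s) \<in> prod.swap ` young_diagram I"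
    unfolding max_h_def set_vertical_steps_swap[symmetric]
    by (rule bounded_diagram.Max_vertical_steps_attained) blast
  then show ?thesis by (intro that[of a b]) (simp_all only: mem_swap not_False_eq_True)
qed

text \<open>
  The space spanned by the \<open>y\<^sup>s \<partial>/\<partial>x\<close> and \<open>x\<^sup>r \<partial>/\<partial>y\<close> of the proof idea; the coefficients of both
  families are concatenated in one vector.
\<close>

definition param :: "complex vec \<Rightarrow> complex poly poly set \<times> complex poly poly set" where
  "param w = (residue_class I (poly_y max_v (\<lambda>s. w $ s)), residue_class I (poly_x max_h (\<lambda>r. w $ (max_v + r))))"

lemma param_linear:
  assumes "w \<in> carrier_vec (max_v + max_h)" "w' \<in> carrier_vec (max_v + max_h)"
  shows "param (w + w') = param w \<oplus>\<^bsub>direct_sum (coord_space I) (coord_space I)\<^esub> param w'"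
    and "param (c \<cdot>\<^sub>v w) = c \<odot>\<^bsub>direct_sum (coord_space I) (coord_space I)\<^esub> param w"
    and "param w \<in> carrier (direct_sum (coord_space I) (coord_space I))"
proof -
  \<comment> \<open>Vector entries add and scale as expected only for indices below the dimension;
    the summation ranges stay below it.\<close>
  have "poly_y max_v (\<lambda>s. (w + w') $ s) = poly_y max_v (\<lambda>s. w $ s + w' $ s)"
    "poly_x max_h (\<lambda>r. (w + w') $ (max_v + r)) = poly_x max_h (\<lambda>r. w $ (max_v + r) + w' $ (max_v + r))"
    "poly_y max_v (\<lambda>s. (c \<cdot>\<^sub>v w) $ s) = poly_y max_v (\<lambda>s. c * w $ s)"
    "poly_x max_h (\<lambda>r. (c \<cdot>\<^sub>v w) $ (max_v + r)) = poly_x max_h (\<lambda>r. c * w $ (max_v + r))"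
    using assms by (auto simp: poly_y_def poly_x_def intro!: sum.cong)
  then show "param (w + w') = param w \<oplus>\<^bsub>direct_sum (coord_space I) (coord_space I)\<^esub> param w'"
    and "param (c \<cdot>\<^sub>v w) = c \<odot>\<^bsub>direct_sum (coord_space I) (coord_space I)\<^esub> param w"
    and "param w \<in> carrier (direct_sum (coord_space I) (coord_space I))"
    by (simp_all only: param_def poly_xy_add poly_xy_scale)
      (simp_all add: direct_sum_def coord_space_def over_C_def quot_module_def
        residue_add residue_mult residue_closed del: mult_pCons_left)
qed

text \<open>From an arbitrary pair (u, v), only the powers y^s with s < \<open>max_v\<close> in u
  and x^r with r < \<open>max_h\<close> in v are kept. What is dropped preserves \<open>I\<close> by
  \<open>mult_dx_mem\<close> and \<open>mult_dy_mem\<close>.\<close>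

lemma alpha_param_image:
  "(alpha_fiber I \<circ> param) ` carrier_vec (max_v + max_h) =
    alpha_fiber I ` carrier (direct_sum (coord_space I) (coord_space I))"
proof (intro equalityI subsetI)
  fix x assume "x \<in> (alpha_fiber I \<circ> param) ` carrier_vec (max_v + max_h)"
  then show "x \<in> alpha_fiber I ` carrier (direct_sum (coord_space I) (coord_space I))"
    using param_linear(3) by auto
next
  fix x assume "x \<in> alpha_fiber I ` carrier (direct_sum (coord_space I) (coord_space I))"
  then obtain u v where x: "x = alpha_fiber I (residue_class I u, residue_class I v)"
    by (auto simp: direct_sum_def coord_space_def over_C_def quot_module_def carrier_quot)
  define w where "w = vec (max_v + max_h)
    (\<lambda>k. if k < max_v then coeff (coeff u k) 0 else coeff (coeff v 0) (k - max_v))"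
  have "x = (alpha_fiber I \<circ> param) w"
    unfolding x comp_apply param_def alpha_fiber_residue_eq_iff
    by (intro ballI add_mem mult_dx_mem[OF max_v_shift] mult_dy_mem[OF max_h_shift])
      (auto simp: coeff_coeff_poly_y coeff_coeff_poly_x w_def)
  moreover have "w \<in> carrier_vec (max_v + max_h)" by (simp add: w_def)
  ultimately show "x \<in> (alpha_fiber I \<circ> param) ` carrier_vec (max_v + max_h)" by blast
qed

text \<open>The difference of two parameters gives a derivation preserving \<open>I\<close>. Applied
  to a monomial at the foot of a longest step, it must have zero coefficients inside the diagram,
  and these coefficients are nonzero multiples of the entries in question.\<close>

lemma alpha_param_inj: "inj_on (alpha_fiber I \<circ> param) (carrier_vec (max_v + max_h))"
proof (rule inj_onI)
  fix w w' :: "complex vec"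
  assume w: "w \<in> carrier_vec (max_v + max_h)" "w' \<in> carrier_vec (max_v + max_h)"
    and eq: "(alpha_fiber I \<circ> param) w = (alpha_fiber I \<circ> param) w'"
  define U where "U = poly_y max_v (\<lambda>s. w $ s) - poly_y max_v (\<lambda>s. w' $ s)"
  define V where "V = poly_x max_h (\<lambda>r. w $ (max_v + r)) - poly_x max_h (\<lambda>r. w' $ (max_v + r))"
  have U: "coeff (coeff U j) i = (if i = 0 \<and> j < max_v then w $ j - w' $ j else 0)" for i j
    by (simp add: U_def coeff_coeff_poly_y)
  have V: "coeff (coeff V j) i = (if j = 0 \<and> i < max_h then w $ (max_v + i) - w' $ (max_v + i) else 0)" for i j
    by (simp add: V_def coeff_coeff_poly_x)
  have mem: "U * dx f + V * dy f \<in> I" if "f \<in> I" for f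
    using eq that unfolding comp_apply param_def alpha_fiber_residue_eq_iff U_def V_def by blast
  have "w $ s = w' $ s" if s: "s < max_v" for s
  proof -
    obtain a b where ab: "(Suc a, b) \<notin> young_diagram I" "(a, b + s) \<in> young_diagram I"
      using max_v_attained s by metis
    let ?f = "monomial_xy (Suc a) b"
    have "coeff (coeff (U * dx ?f + V * dy ?f) (b + s)) a = 0"
      using coeff_coeff_mem[OF mem] ab by (auto simp: young_diagram_def)
    \<comment> \<open>Differentiating in y keeps the x-degree a + 1, and multiplication by V cannot
      lower it to a.\<close>
    moreover have "coeff (coeff (V * dy ?f) (b + s)) a = 0"
      by (rule ccontr, erule coeff_coeff_mult_nonzeroE)
        (auto simp: coeff_coeff_dy coeff_coeff_monomial_xy split: if_splits)
    ultimately have "of_nat (Suc a) * coeff (coeff U s) 0 = 0"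
      using coeff_coeff_mult_dx_monomial_xy[of U a b s 0] by simp
    then show ?thesis using s by (simp add: U del: of_nat_Suc)
  qed
  moreover have "w $ (max_v + r) = w' $ (max_v + r)" if r: "r < max_h" for r
  proof -
    obtain a b where ab: "(a, Suc b) \<notin> young_diagram I" "(a + r, b) \<in> young_diagram I"
      using max_h_attained r by metis
    let ?f = "monomial_xy a (Suc b)"
    have "coeff (coeff (U * dx ?f + V * dy ?f) b) (a + r) = 0"
      using coeff_coeff_mem[OF mem] ab by (auto simp: young_diagram_def)
    \<comment> \<open>Here the y-degree stays at least b + 1.\<close>
    moreover have "coeff (coeff (U * dx ?f) b) (a + r) = 0"
      by (rule ccontr, erule coeff_coeff_mult_nonzeroE)
        (auto simp: coeff_coeff_dx coeff_coeff_monomial_xy split: if_splits)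
    ultimately have "of_nat (Suc b) * coeff (coeff V 0) r = 0"
      using coeff_coeff_mult_dy_monomial_xy[of V a b 0 r] by simp
    then show ?thesis using r by (simp add: V del: of_nat_Suc)
  qed
  \<comment> \<open>An index not below \<open>max_v\<close> is \<open>max_v\<close> + r with r <
    \<open>max_h\<close>, so the two families cover all entries.\<close>
  ultimately show "w = w'"
    using w by (intro eq_vecI) (auto, metis add.commute le_add_diff_inverse nat_add_left_cancel_less not_less)
qed

text \<open>The composite with \<open>param\<close> is an injective linear map on the standard space
  of dimension \<open>max_v\<close> + \<open>max_h\<close>, and it has the same image as
  \<open>alpha_fiber I\<close>. Rank-nullity then gives the rank.\<close>

lemma rank_alpha_eq: "rank_alpha I = max_v + max_h"
proof -
  interpret alpha: linear_map CC "direct_sum (coord_space I) (coord_space I)" "normal_space I" "alpha_fiber I"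
    by (rule alpha_fiber_linear) (rule ideal_I)
  let ?V = "module_vec TYPE(complex) (max_v + max_h)"
  let ?T = "alpha_fiber I \<circ> param"
  have "?T \<in> LinearCombinations.module_hom CC ?V (normal_space I)"
    using alpha.T_hom param_linear
    by (auto simp: LinearCombinations.module_hom_def module_vec_simps)
  then interpret T: linear_map CC ?V "normal_space I" ?T
    by (intro linear_map.intro mod_hom.intro mod_hom_axioms.intro vec_vs alpha.W.vectorspace_axioms
        vec_module vectorspace.axioms(1)[OF alpha.W.vectorspace_axioms])
  have "vectorspace.dim CC (normal_space I\<lparr>carrier := T.im\<rparr>) = max_v + max_h"
    using T.rank_nullity T.inj_imp_dim_ker0 alpha_param_inj
    by (simp add: vec_space.fin_dim vec_space.dim_is_n module_vec_simps)
  moreover have "T.im = alpha_fiber I ` carrier (direct_sum (coord_space I) (coord_space I))"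
    unfolding T.im_def by (simp only: module_vec_simps alpha_param_image)
  ultimately show ?thesis by (simp add: rank_alpha_def linear_rank_def)
qed

end

text \<open>If 1 lies in \<open>I\<close>, the quotient is zero. This excludes the unit ideal once
  the length is positive.\<close>

lemma (in plane_ideal) dim_coord_space_trivial:
  assumes "monomial_xy 0 0 \<in> I"
  shows "vectorspace.dim CC (coord_space I) = 0"
proof -
  have "f \<in> I" for f
    using mult_mem[OF assms, of f] by (simp add: monomial_xy_def monom_0 flip: one_pCons)
  then have carrier: "carrier (coord_space I) = {\<zero>\<^bsub>coord_space I\<^esub>}"
    using residue_eq_iff[of _ 0] residue.hom_zero
    by (simp add: coord_space_def over_C_def quot_module_def carrier_quot image_constant_conv)
  interpret V: vectorspace CC "coord_space I"
    unfolding coord_space_def by (intro vectorspace_over_C module_quot ideal_I)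
  show ?thesis
    using V.span_is_subset2[of "{\<zero>\<^bsub>coord_space I\<^esub>}"] V.in_own_span[of "{\<zero>\<^bsub>coord_space I\<^esub>}"] carrier
    by (intro V.dim0I) auto
qed

theorem theoremB:
  fixes n :: nat and I :: "complex poly poly set"
  assumes "n \<ge> 1"
    and "closed_subscheme_of_length n I"
    and "supported_at_origin I"
    and "monomial_ideal I"
  shows "rank_alpha I =
    Max (set (horizontal_steps (young_diagram I))) + Max (set (vertical_steps (young_diagram I)))"
proof -
  interpret plane_ideal I
    using assms(2) by (intro plane_ideal.intro) (simp add: closed_subscheme_of_length_def)
  have "monomial_xy 0 0 \<notin> I"
    using assms(1,2) dim_coord_space_trivial by (auto simp: closed_subscheme_of_length_def)
  with assms interpret punctual_monomial_ideal I
    by unfold_locales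
  show ?thesis using rank_alpha_eq by (simp add: max_v_def max_h_def)
qed

end
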